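(* Let $N,K\in\mathbb{N}$ and let $S=\bigl([-N-K,-N]\cup[N,N+K]\bigr)\cap\mathbb{Z}$. Then $$M(S)=\frac{K+1}{2N+K}.$$
   Context: For a finite set $S\subset\mathbb{Z}$ with $0\notin S$, define $$M(S):=\sup_{f}\ \sup_{I}\,|I|,$$ where the first supremum is over all real-valued trigonometric polynomials $f(t)=\sum_{\lambda}\hat f(\lambda)e^{2\pi i\lambda t}$ on $\mathbb{R}/\mathbb{Z}$ whose spectrum $\operatorname{spec} f=\{\lambda\in\mathbb{Z}:\hat f(\lambda)\neq 0\}$ (the support of the Fourier transform) is contained in $S$, and the second supremum is over all intervals $I\subset[0,1]$ such that $f$ has no zero on $I$; $|I|$ denotes the length of $I$. $\mathbb{N}$ denotes the positive integers. *)

theory Defs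
  imports "HOL-Analysis.Analysis"
begin

text \<open>Functions on $\mathbb{R}/\mathbb{Z}$ are represented by functions on the reals; those satisfying
  \<open>trig_polynomial\<close> are automatically 1-periodic.\<close>

definition fourier_coeff :: "(real \<Rightarrow> real) \<Rightarrow> int \<Rightarrow> complex" where
  "fourier_coeff f k =
     integral {0..1} (\<lambda>t. complex_of_real (f t) * exp (- (2 * pi * \<i> * of_int k * of_real t)))"

definition spec :: "(real \<Rightarrow> real) \<Rightarrow> int set" where
  "spec f = {k. fourier_coeff f k \<noteq> 0}"

definition trig_polynomial :: "(real \<Rightarrow> real) \<Rightarrow> bool" where
  "trig_polynomial f \<longleftrightarrow>
     finite (spec f) \<and>
     (\<forall>t. complex_of_real (f t) =
            (\<Sum>k\<in>spec f. fourier_coeff f k * exp (2 * pi * \<i> * of_int k * of_real t)))"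

text \<open>Both suprema are taken over nonempty sets of reals contained in $[0,1]$: the zero
  polynomial and the empty interval are always admitted, and contribute the value 0.
  The intervals may be open, closed or half-open.\<close>

definition zero_free_intervals :: "(real \<Rightarrow> real) \<Rightarrow> real set set" where
  "zero_free_intervals f = {I. is_interval I \<and> I \<subseteq> {0..1} \<and> (\<forall>t\<in>I. f t \<noteq> 0)}"

definition M :: "int set \<Rightarrow> real" where
  "M S = (SUP f\<in>{f. trig_polynomial f \<and> spec f \<subseteq> S}.
            SUP I\<in>zero_free_intervals f. measure lborel I)"

end

theory Submission
  imports Defs
begin

text \<open>
  Write \<open>n = 2N + K\<close>. Modulo \<open>n\<close> the two blocks of \<open>S\<close> coincide: they occupy only the
  \<open>K + 1\<close> residues \<open>N, \<dots>, N + K\<close>.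

  Upper bound. There are strictly positive masses \<open>m\<^sub>0, \<dots>, m\<^bsub>K+1\<^esub>\<close> such that
  \<open>\<Sum>j. m\<^sub>j f(a + j/n) = 0\<close> for every \<open>a\<close> and every \<open>f\<close> with spectrum in \<open>S\<close>
  (lemma \<open>quadrature\<close>). Such an \<open>f\<close> cannot have constant sign on an interval that contains all
  the nodes, so a zero-free interval cannot contain two points at distance more than \<open>(K + 1)/n\<close>.
  The masses are the coefficients of the polynomial of degree \<open>K + 1\<close> with the zeros
  \<open>exp (2\<pi>\<i>k/n)\<close>, \<open>N \<le> k \<le> N + K\<close>. These zeros are a geometric progression placed
  symmetrically about \<open>-1\<close>, so by the q-binomial theorem the coefficients are symmetric
  q-binomials, which are products of quotients of sines of angles in \<open>(0, \<pi>)\<close>.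

  Lower bound. The function \<open>sin (\<pi>nt) \<Prod>j=1..K. sin (\<pi>(j/n - t))\<close> has spectrum in \<open>S\<close>.
  On \<open>(0, (K + 1)/n)\<close> every sign change of the first factor is cancelled by one in the product,
  so it is nonnegative there, and it vanishes there only at the points \<open>j/n\<close>
  (lemma \<open>extremal_sign\<close>).
  Adding its translate by a small \<open>s > 0\<close>, whose zeros are elsewhere, gives a function which is
  positive on \<open>(s, (K + 1)/n)\<close>.
\<close>

section \<open>Trigonometric polynomials with prescribed frequencies\<close>

lemma exp_eq_cis: "exp (2 * pi * \<i> * of_int k * of_real t) = cis (2 * pi * of_int k * t)"
  by (simp add: cis_conv_exp mult_ac)

lemma integral_cis_int:
  "((\<lambda>t. cis (2 * pi * of_int m * t)) has_integral (if m = 0 then 1 else 0)) {0..1}"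
proof (cases "m = 0")
  case True
  then show ?thesis
    using has_integral_const_real[of "1::complex" 0 1] by simp
next
  case False
  define w :: complex where "w = 2 * pi * \<i> * of_int m"
  have w: "w \<noteq> 0" using False by (simp add: w_def)
  have "((\<lambda>t. exp (w * of_real t)) has_integral (exp (w * of_real 1) / w - exp (w * of_real 0) / w)) {0..1}"
    by (rule fundamental_theorem_of_calculus)
       (auto intro!: derivative_eq_intros has_vector_derivative_real_field simp: w)
  moreover have "exp (w * of_real t) = cis (2 * pi * of_int m * t)" for t
    by (simp add: w_def cis_conv_exp mult_ac)
  moreover from this[of 1] have "exp w = 1"
    by (simp add: cis_multiple_2pi)
  ultimately show ?thesis using False by simp
qed

text \<open>The real-valued functions that are complex linear combinations of the exponentials with
  frequency in \<open>A\<close>. For finite \<open>A\<close> these are the trigonometric polynomials with spectrum in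
  \<open>A\<close>, but no reference to Fourier coefficients is needed to establish membership; for infinite
  \<open>A\<close> the sum is 0 by default and only the zero function remains.\<close>

definition trig_span :: "int set \<Rightarrow> (real \<Rightarrow> real) set" where
  "trig_span A = {f. \<exists>c. \<forall>t. complex_of_real (f t) = (\<Sum>k\<in>A. c k * cis (2 * pi * of_int k * t))}"

lemma trig_spanI:
  assumes "\<And>t. complex_of_real (f t) = (\<Sum>k\<in>A. c k * cis (2 * pi * of_int k * t))"
  shows "f \<in> trig_span A"
  using assms unfolding trig_span_def by blast

lemma trig_span_add:
  assumes "f \<in> trig_span A" "g \<in> trig_span A"
  shows "(\<lambda>t. f t + g t) \<in> trig_span A"
proof -
  obtain c d where
    "\<And>t. complex_of_real (f t) = (\<Sum>k\<in>A. c k * cis (2 * pi * of_int k * t))"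
    "\<And>t. complex_of_real (g t) = (\<Sum>k\<in>A. d k * cis (2 * pi * of_int k * t))"
    using assms unfolding trig_span_def by auto
  then show ?thesis
    by (intro trig_spanI[where c = "\<lambda>k. c k + d k"]) (simp add: sum.distrib ring_distribs)
qed

lemma trig_span_translate:
  assumes "f \<in> trig_span A"
  shows "(\<lambda>t. f (t - s)) \<in> trig_span A"
proof -
  obtain c where
    c: "\<And>t. complex_of_real (f t) = (\<Sum>k\<in>A. c k * cis (2 * pi * of_int k * t))"
    using assms unfolding trig_span_def by auto
  show ?thesis
    by (rule trig_spanI[where c = "\<lambda>k. c k * cis (- (2 * pi * of_int k * s))"])
       (simp add: c mult.assoc cis_mult right_diff_distrib)
qed

lemma fourier_coeff_trig_sum:
  assumes "finite A"
    and f: "\<And>t. complex_of_real (f t) = (\<Sum>k\<in>A. c k * cis (2 * pi * of_int k * t))"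
  shows "fourier_coeff f l = (if l \<in> A then c l else 0)"
proof -
  have "complex_of_real (f t) * exp (- (2 * pi * \<i> * of_int l * of_real t))
      = (\<Sum>k\<in>A. c k * cis (2 * pi * of_int (k - l) * t))" for t
  proof -
    have "exp (- (2 * pi * \<i> * of_int l * of_real t)) = cis (- (2 * pi * of_int l * t))"
      using exp_eq_cis[of "- l" t] by simp
    then show ?thesis
      by (simp add: f sum_distrib_right mult.assoc cis_mult left_diff_distrib right_diff_distrib)
  qed
  moreover have "((\<lambda>t. \<Sum>k\<in>A. c k * cis (2 * pi * of_int (k - l) * t)) has_integral
      (\<Sum>k\<in>A. c k * (if k - l = 0 then 1 else 0))) {0..1}"
    by (intro has_integral_sum assms has_integral_mult_right integral_cis_int)
  moreover have "(\<Sum>k\<in>A. c k * (if k - l = 0 then 1 else 0)) = (if l \<in> A then c l else 0)"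
    using \<open>finite A\<close> by (simp add: if_distrib[of "\<lambda>x. _ * x"] sum.delta cong: if_cong)
  ultimately show ?thesis
    unfolding fourier_coeff_def by (simp add: integral_unique)
qed

lemma trig_polynomial_iff_trig_span:
  assumes "finite A"
  shows "trig_polynomial f \<and> spec f \<subseteq> A \<longleftrightarrow> f \<in> trig_span A"
proof
  assume *: "trig_polynomial f \<and> spec f \<subseteq> A"
  show "f \<in> trig_span A"
  proof (rule trig_spanI)
    fix t
    have "complex_of_real (f t) = (\<Sum>k\<in>spec f. fourier_coeff f k * cis (2 * pi * of_int k * t))"
      using * unfolding trig_polynomial_def exp_eq_cis by blast
    also have "\<dots> = (\<Sum>k\<in>A. fourier_coeff f k * cis (2 * pi * of_int k * t))"
      using * assms by (intro sum.mono_neutral_left) (auto simp: spec_def)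
    finally show "complex_of_real (f t) = \<dots>" .
  qed
next
  assume "f \<in> trig_span A"
  then obtain c where
    c: "\<And>t. complex_of_real (f t) = (\<Sum>k\<in>A. c k * cis (2 * pi * of_int k * t))"
    unfolding trig_span_def by auto
  note fc = fourier_coeff_trig_sum[OF assms c]
  have sub: "spec f \<subseteq> A"
    by (auto simp: spec_def fc split: if_splits)
  have "complex_of_real (f t) = (\<Sum>k\<in>spec f. fourier_coeff f k * cis (2 * pi * of_int k * t))" for t
    unfolding c using sub assms
    by (intro sum.mono_neutral_cong_right) (auto simp: fc spec_def)
  then show "trig_polynomial f \<and> spec f \<subseteq> A"
    using sub finite_subset[OF sub assms] unfolding trig_polynomial_def exp_eq_cis by blast
qed

lemma trig_span_continuous:
  assumes "f \<in> trig_span A"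
  shows "continuous_on X f"
proof -
  obtain c where
    c: "\<And>t. complex_of_real (f t) = (\<Sum>k\<in>A. c k * cis (2 * pi * of_int k * t))"
    using assms unfolding trig_span_def by auto
  have "continuous_on X (\<lambda>t. Re (\<Sum>k\<in>A. c k * cis (2 * pi * of_int k * t)))"
    by (intro continuous_intros)
  then show ?thesis
    unfolding c[symmetric] by simp
qed

section \<open>A quadrature formula with positive weights\<close>

text \<open>The symmetric Gaussian binomial coefficient of \<open>L\<close> over \<open>j\<close> at \<open>q = exp (2\<i>\<theta>)\<close>. Subtraction
  is done in the reals; the value is 0 for \<open>j > L\<close>, since the numerator with \<open>i = L\<close> is \<open>sin 0\<close>.\<close>

definition sine_binomial :: "real \<Rightarrow> nat \<Rightarrow> nat \<Rightarrow> real" where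
  "sine_binomial \<theta> L j = (\<Prod>i<j. sin ((real L - real i) * \<theta>) / sin ((real i + 1) * \<theta>))"

lemma sine_binomial_Suc:
  assumes "sin ((real j + 1) * \<theta>) \<noteq> 0"
  shows "sine_binomial \<theta> L (Suc j) * sin ((real j + 1) * \<theta>)
       = sine_binomial \<theta> L j * sin ((real L - real j) * \<theta>)"
  using assms by (simp add: sine_binomial_def)

lemma sine_binomial_pos:
  assumes "0 < \<theta>" "real L * \<theta> < pi" "j \<le> L"
  shows "0 < sine_binomial \<theta> L j"
  unfolding sine_binomial_def
proof (intro prod_pos divide_pos_pos)
  fix i assume "i \<in> {..<j}"
  with assms have i: "real i + 1 \<le> real L" by simp
  then have "(real i + 1) * \<theta> \<le> real L * \<theta>" "(real L - real i) * \<theta> \<le> real L * \<theta>"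
    using assms by (auto intro!: mult_right_mono)
  then have "(real i + 1) * \<theta> < pi" "(real L - real i) * \<theta> < pi"
    using assms(2) by linarith+
  with assms i show "0 < sin ((real L - real i) * \<theta>)" "0 < sin ((real i + 1) * \<theta>)"
    by (auto intro!: sin_gt_zero mult_pos_pos)
qed

text \<open>The generating polynomial \<open>\<Sum>j\<le>L. m\<^sub>j z\<^sup>j\<close> of the symmetric Gaussian binomials, evaluated at
  \<open>z = exp (\<i>\<phi>)\<close>.\<close>

definition sine_binomial_sum :: "real \<Rightarrow> nat \<Rightarrow> real \<Rightarrow> complex" where
  "sine_binomial_sum \<theta> L \<phi> = (\<Sum>j\<le>L. of_real (sine_binomial \<theta> L j) * cis (real j * \<phi>))"

lemma two_i_sin: "2 * \<i> * of_real (sin x) = cis x - cis (- x)"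
  by (simp add: complex_eq_iff)

text \<open>The two-term recursion of the coefficients, summed against \<open>exp (\<i>j\<psi>)\<close>. The resulting
  functional equation carries a zero of the generating polynomial from one angle to the next at
  distance \<open>2\<theta>\<close> as long as the factor on the left is nonzero, and it forces a first zero where
  the factor on the right vanishes. This locates the zeros without the product form of the
  q-binomial theorem.\<close>

lemma sine_binomial_sum_functional:
  assumes nz: "\<And>j. j < L \<Longrightarrow> sin ((real j + 1) * \<theta>) \<noteq> 0"
  shows "(1 + cis (\<psi> - L * \<theta>)) * sine_binomial_sum \<theta> L (\<psi> + \<theta>)
       = (1 + cis (\<psi> + L * \<theta>)) * sine_binomial_sum \<theta> L (\<psi> - \<theta>)"
proof -
  define m where "m j = complex_of_real (sine_binomial \<theta> L j)" for j
  define G where "G = sine_binomial_sum \<theta> L"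
  have G: "G \<phi> = (\<Sum>j\<le>L. m j * cis (real j * \<phi>))" for \<phi>
    by (simp add: G_def sine_binomial_sum_def m_def)
  \<comment> \<open>The term \<open>j = 0\<close> on the left and, further down, the term \<open>j = L\<close> on the right are zero.\<close>
  have "(\<Sum>j\<le>L. m j * of_real (sin (real j * \<theta>)) * cis (real j * \<psi>))
      = (\<Sum>j<L. m (Suc j) * of_real (sin ((real j + 1) * \<theta>)) * cis ((real j + 1) * \<psi>))"
    by (subst sum.atMost_shift) (simp add: add.commute)
  also have "\<dots> = (\<Sum>j<L. cis \<psi> * (m j * of_real (sin ((real L - real j) * \<theta>)) * cis (real j * \<psi>)))"
  proof (rule sum.cong[OF refl])
    fix j assume "j \<in> {..<L}"
    then have 1: "m (Suc j) * of_real (sin ((real j + 1) * \<theta>)) = m j * of_real (sin ((real L - real j) * \<theta>))"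
      unfolding m_def of_real_mult[symmetric] using sine_binomial_Suc nz by simp
    have 2: "cis ((real j + 1) * \<psi>) = cis \<psi> * cis (real j * \<psi>)"
      by (simp add: cis_mult algebra_simps)
    show "m (Suc j) * of_real (sin ((real j + 1) * \<theta>)) * cis ((real j + 1) * \<psi>)
        = cis \<psi> * (m j * of_real (sin ((real L - real j) * \<theta>)) * cis (real j * \<psi>))"
      unfolding 1 2 by (simp only: mult_ac)
  qed
  also have "\<dots> = (\<Sum>j\<le>L. cis \<psi> * (m j * of_real (sin ((real L - real j) * \<theta>)) * cis (real j * \<psi>)))"
    by (simp add: lessThan_Suc_atMost[symmetric])
  finally have eq: "(\<Sum>j\<le>L. m j * of_real (sin (real j * \<theta>)) * cis (real j * \<psi>))
      = (\<Sum>j\<le>L. cis \<psi> * (m j * of_real (sin ((real L - real j) * \<theta>)) * cis (real j * \<psi>)))" .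
  have "(\<Sum>j\<le>L. m j * (2 * \<i> * of_real (sin (real j * \<theta>))) * cis (real j * \<psi>))
      = (\<Sum>j\<le>L. cis \<psi> * (m j * (2 * \<i> * of_real (sin ((real L - real j) * \<theta>))) * cis (real j * \<psi>)))"
    using arg_cong[OF eq, of "\<lambda>x. 2 * \<i> * x"] unfolding sum_distrib_left by (simp only: mult_ac)
  also have "(\<Sum>j\<le>L. m j * (2 * \<i> * of_real (sin (real j * \<theta>))) * cis (real j * \<psi>))
      = G (\<psi> + \<theta>) - G (\<psi> - \<theta>)"
    unfolding two_i_sin G sum_subtractf[symmetric]
    by (intro sum.cong refl) (simp add: algebra_simps cis_mult)
  also have "(\<Sum>j\<le>L. cis \<psi> * (m j * (2 * \<i> * of_real (sin ((real L - real j) * \<theta>))) * cis (real j * \<psi>)))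
      = cis (\<psi> + L * \<theta>) * G (\<psi> - \<theta>) - cis (\<psi> - L * \<theta>) * G (\<psi> + \<theta>)"
    unfolding two_i_sin G sum_subtractf[symmetric] sum_distrib_left
    by (intro sum.cong refl) (simp add: algebra_simps cis_mult mult.left_commute[of "cis \<psi>"])
  finally show ?thesis
    unfolding G_def[symmetric] by (simp add: algebra_simps)
qed

lemma one_plus_cis_nonzero:
  assumes "\<bar>x\<bar> < pi"
  shows "1 + cis x \<noteq> 0"
proof
  assume "1 + cis x = 0"
  then have "cos x = -1" "sin x = 0"
    by (auto simp: complex_eq_iff)
  moreover from this assms have "x = 0"
    by (auto simp: abs_less_iff intro: sin_eq_0_pi)
  ultimately show False by simp
qed

lemma sine_binomial_sum_eq_0:
  fixes N K :: nat and k :: int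
  assumes "1 \<le> N" and k: "int N \<le> k" "k \<le> int (N + K)"
  defines "n \<equiv> 2 * real N + real K"
  shows "sine_binomial_sum (pi / n) (K + 1) (2 * pi * of_int k / n) = 0"
proof -
  define \<theta> where "\<theta> = pi / n"
  have n: "0 < n" using assms(1) by (simp add: n_def)
  have \<theta>: "0 < \<theta>" "n * \<theta> = pi" using n by (auto simp: \<theta>_def)
  have nz: "sin ((real j + 1) * \<theta>) \<noteq> 0" if "j < K + 1" for j
  proof -
    have "real j + 1 < n" using that assms(1) by (simp add: n_def)
    then have "(real j + 1) * \<theta> < pi" using \<theta> mult_strict_right_mono[of "real j + 1" n \<theta>] by simp
    then have "0 < sin ((real j + 1) * \<theta>)" using \<theta> by (intro sin_gt_zero) auto
    then show ?thesis by simp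
  qed
  have lt: "\<bar>x * \<theta>\<bar> < pi" if "\<bar>x\<bar> < n" for x
    using mult_strict_right_mono[OF that \<theta>(1)] \<theta> by (simp add: abs_mult)
  \<comment> \<open>This is the functional equation at \<open>\<psi> = (2i - 1)\<theta>\<close>. The factor of the value at \<open>2i\<theta>\<close> is
    nonzero because \<open>\<bar>2i - 2 - K\<bar> < n\<close> for \<open>N \<le> i \<le> N + K\<close>.\<close>
  have shift: "sine_binomial_sum \<theta> (K + 1) (2 * of_int i * \<theta>) = 0"
    if i: "int N \<le> i" "i \<le> int (N + K)"
      and rhs: "(1 + cis ((2 * of_int i + real K) * \<theta>)) * sine_binomial_sum \<theta> (K + 1) (2 * of_int (i - 1) * \<theta>) = 0" for i
  proof -
    have "real N \<le> of_int i" "of_int i \<le> real N + real K" using i by linarith+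
    then have "\<bar>2 * of_int i - 2 - real K\<bar> < n" using assms(1) by (simp add: n_def)
    then have "1 + cis ((2 * of_int i - 2 - real K) * \<theta>) \<noteq> 0"
      by (intro one_plus_cis_nonzero lt)
    moreover have "(1 + cis ((2 * of_int i - 2 - real K) * \<theta>)) * sine_binomial_sum \<theta> (K + 1) (2 * of_int i * \<theta>) = 0"
      using sine_binomial_sum_functional[of "K + 1" \<theta> "(2 * of_int i - 1) * \<theta>"] nz rhs
      by (simp add: algebra_simps)
    ultimately show ?thesis by simp
  qed
  have "k \<le> int (N + K) \<longrightarrow> sine_binomial_sum \<theta> (K + 1) (2 * of_int k * \<theta>) = 0"
    using k(1)
  proof (induction k rule: int_ge_induct)
    case base
    \<comment> \<open>The first zero: here the factor \<open>1 + cis (n\<theta>)\<close> on the right vanishes.\<close>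
    have "(2 * of_int (int N) + real K) * \<theta> = pi" using \<theta> by (simp add: n_def)
    then show ?case by (intro impI shift) simp_all
  next
    case (step i)
    show ?case
    proof (intro impI shift)
      assume le: "i + 1 \<le> int (N + K)"
      then show "int N \<le> i + 1" "i + 1 \<le> int (N + K)" using step.hyps by auto
      show "(1 + cis ((2 * of_int (i + 1) + real K) * \<theta>)) *
          sine_binomial_sum \<theta> (K + 1) (2 * of_int (i + 1 - 1) * \<theta>) = 0"
        using step.IH le by simp
    qed
  qed
  then show ?thesis using k(2) by (simp add: \<theta>_def mult_ac)
qed

lemma sine_binomial_sum_minus:
  "sine_binomial_sum \<theta> L (- \<phi>) = cnj (sine_binomial_sum \<theta> L \<phi>)"
  by (simp add: sine_binomial_sum_def cis_cnj)

lemma quadrature: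
  fixes N K :: nat
  assumes "1 \<le> N"
    and f: "f \<in> trig_span ({- int N - int K .. - int N} \<union> {int N .. int N + int K})"
  defines "n \<equiv> 2 * real N + real K"
  shows "(\<Sum>j\<le>K + 1. sine_binomial (pi / n) (K + 1) j * f (a + real j / n)) = 0"
proof -
  define S where "S = {- int N - int K .. - int N} \<union> {int N .. int N + int K}"
  define m where "m = sine_binomial (pi / n) (K + 1)"
  obtain c where
    c: "\<And>t. complex_of_real (f t) = (\<Sum>k\<in>S. c k * cis (2 * pi * of_int k * t))"
    using f unfolding trig_span_def S_def by auto
  have zero: "sine_binomial_sum (pi / n) (K + 1) (2 * pi * of_int k / n) = 0" if k: "k \<in> S" for k
  proof (cases "k \<ge> 0")
    case True
    with k assms(1) show ?thesis
      unfolding n_def by (intro sine_binomial_sum_eq_0) (auto simp: S_def)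
  next
    case False
    with k assms(1) have "sine_binomial_sum (pi / n) (K + 1) (2 * pi * of_int (- k) / n) = 0"
      unfolding n_def by (intro sine_binomial_sum_eq_0) (auto simp: S_def)
    then show ?thesis
      using sine_binomial_sum_minus[of "pi / n" "K + 1" "2 * pi * of_int k / n"] by simp
  qed
  \<comment> \<open>Expanding \<open>f\<close> and exchanging the sums leaves only values at zeros.\<close>
  have "complex_of_real (\<Sum>j\<le>K + 1. m j * f (a + real j / n))
      = (\<Sum>j\<le>K + 1. \<Sum>k\<in>S. of_real (m j) * (c k * cis (2 * pi * of_int k * (a + real j / n))))"
    by (simp only: of_real_sum of_real_mult c sum_distrib_left)
  also have "\<dots> = (\<Sum>k\<in>S. c k * cis (2 * pi * of_int k * a) * sine_binomial_sum (pi / n) (K + 1) (2 * pi * of_int k / n))"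
    unfolding sine_binomial_sum_def m_def[symmetric] sum_distrib_left
    by (subst sum.swap) (simp add: cis_mult[symmetric] distrib_left mult_ac)
  also have "\<dots> = 0" using zero by simp
  finally show ?thesis by (simp only: of_real_eq_0_iff m_def)
qed

section \<open>Lengths of zero-free intervals\<close>

lemma constant_sign_on_interval:
  fixes f :: "real \<Rightarrow> real"
  assumes "continuous_on I f" "is_interval I" "\<And>t. t \<in> I \<Longrightarrow> f t \<noteq> 0"
  shows "(\<forall>t\<in>I. 0 < f t) \<or> (\<forall>t\<in>I. f t < 0)"
proof (rule ccontr)
  assume "\<not> ?thesis"
  then obtain x y where xy: "x \<in> I" "y \<in> I" "f x \<le> 0" "0 \<le> f y" by (auto simp: not_less)
  have "is_interval (f ` I)"
    using assms by (simp add: is_interval_connected_1 connected_continuous_image)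
  then have "0 \<in> f ` I" using xy unfolding is_interval_1 by blast
  with assms(3) show False by force
qed

lemma zero_free_distance:
  fixes N K :: nat
  assumes "1 \<le> N"
    and f: "f \<in> trig_span ({- int N - int K .. - int N} \<union> {int N .. int N + int K})"
    and I: "I \<in> zero_free_intervals f" and "x \<in> I" "y \<in> I"
  shows "y - x \<le> (real K + 1) / (2 * real N + real K)"
proof (rule ccontr)
  assume far: "\<not> ?thesis"
  define n where "n = 2 * real N + real K"
  define m where "m = sine_binomial (pi / n) (K + 1)"
  have n: "0 < n" "real K + 1 < n" using assms(1) by (auto simp: n_def)
  have ivl: "is_interval I" and nz: "\<And>t. t \<in> I \<Longrightarrow> f t \<noteq> 0"
    using I by (auto simp: zero_free_intervals_def)
  have mpos: "0 < m j" if "j \<le> K + 1" for j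
  proof -
    have "real (K + 1) * (pi / n) = (real K + 1) / n * pi" by simp
    also have "\<dots> < 1 * pi" using n by (intro mult_strict_right_mono) auto
    finally show ?thesis
      unfolding m_def using that n by (intro sine_binomial_pos) auto
  qed
  have mem: "x + real j / n \<in> I" if "j \<le> K + 1" for j
  proof -
    have "real j / n \<le> (real K + 1) / n" using that n by (intro divide_right_mono) auto
    then have "x \<le> x + real j / n" "x + real j / n \<le> y"
      using far n by (auto simp: n_def)
    then show ?thesis using ivl assms(4,5) unfolding is_interval_1 by blast
  qed
  have sum0: "(\<Sum>j\<le>K + 1. m j * f (x + real j / n)) = 0"
    unfolding m_def n_def by (rule quadrature[OF assms(1) f])
  from constant_sign_on_interval[OF trig_span_continuous[OF f] ivl nz]
  show False
  proof
    assume "\<forall>t\<in>I. 0 < f t"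
    then have "0 < (\<Sum>j\<le>K + 1. m j * f (x + real j / n))"
      using mpos mem by (intro sum_pos) auto
    with sum0 show False by simp
  next
    assume "\<forall>t\<in>I. f t < 0"
    then have "0 < (\<Sum>j\<le>K + 1. - (m j * f (x + real j / n)))"
      using mpos mem by (intro sum_pos) (auto simp: mult_pos_neg)
    with sum0 show False by (simp add: sum_negf)
  qed
qed

lemma measure_interval_le:
  fixes I :: "real set"
  assumes "is_interval I" "I \<subseteq> {a..b}" "0 \<le> d" "\<And>x y. x \<in> I \<Longrightarrow> y \<in> I \<Longrightarrow> y - x \<le> d"
  shows "measure lborel I \<le> d"
proof (cases "I = {}")
  case False
  have bdd: "bdd_below I" using assms(2) by (meson bdd_below_Icc bdd_below_mono)
  have "I \<subseteq> {Inf I..Inf I + d}"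
  proof
    fix y assume y: "y \<in> I"
    have "y - d \<le> Inf I" using False assms(4)[OF _ y] by (intro cInf_greatest) (auto simp: algebra_simps)
    with cInf_lower[OF y bdd] show "y \<in> {Inf I..Inf I + d}" by simp
  qed
  moreover have "I \<in> sets borel"
    using assms(1) by (simp add: real_interval_borel_measurable)
  ultimately have "measure lborel I \<le> measure lborel {Inf I..Inf I + d}"
    using assms(3) by (intro measure_mono_fmeasurable fmeasurableI) auto
  then show ?thesis using assms(3) by simp
qed (use assms in simp)

section \<open>The extremal function\<close>

text \<open>The extremal function for \<open>n = 2N + K\<close>. In \<open>(0, (K + 1)/n)\<close> its zeros are the points \<open>j/n\<close>
  with \<open>1 \<le> j \<le> K\<close>, each of them double; the sign convention \<open>j/n - t\<close> makes it nonnegative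
  there.\<close>

definition extremal :: "real \<Rightarrow> nat \<Rightarrow> real \<Rightarrow> real" where
  "extremal n K t = sin (pi * n * t) * (\<Prod>j=1..K. sin (pi * (real j / n - t)))"

text \<open>A product of \<open>K\<close> sines has the frequencies \<open>-K/2, -K/2 + 1, \<dots>, K/2\<close>, half-integral for odd
  \<open>K\<close>. The factor \<open>cis (- (\<pi>Kt))\<close> is split off so that the remaining frequencies are integers.\<close>

lemma sine_product_expansion:
  fixes x :: "nat \<Rightarrow> real"
  shows "\<exists>b. \<forall>t. complex_of_real (\<Prod>j=1..K. sin (pi * (x j - t)))
      = cis (- (pi * real K * t)) * (\<Sum>i\<le>K. b i * cis (2 * pi * real i * t))"
proof (induction K)
  case 0
  show ?case by (rule exI[of _ "\<lambda>_. 1"]) simp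
next
  case (Suc K)
  then obtain b where b: "\<And>t. complex_of_real (\<Prod>j=1..K. sin (pi * (x j - t)))
      = cis (- (pi * real K * t)) * (\<Sum>i\<le>K. b i * cis (2 * pi * real i * t))" by blast
  define u where "u = cis (pi * x (Suc K)) / (2 * \<i>)"
  define v where "v = - (cis (- (pi * x (Suc K))) / (2 * \<i>))"
  define b' where "b' i = (if i \<le> K then u * b i else 0) + (if i = 0 then 0 else v * b (i - 1))" for i
  show ?case
  proof (intro exI allI)
    fix t
    define p where "p = (\<Sum>i\<le>K. b i * cis (2 * pi * real i * t))"
    have "complex_of_real (sin (pi * (x (Suc K) - t)))
        = (cis (pi * (x (Suc K) - t)) - cis (- (pi * (x (Suc K) - t)))) / (2 * \<i>)"
      unfolding two_i_sin[symmetric] by simp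
    also have "\<dots> = cis (- (pi * t)) * (u + v * cis (2 * pi * t))"
      by (simp add: u_def v_def divide_simps cis_mult algebra_simps)
    finally have s: "complex_of_real (sin (pi * (x (Suc K) - t))) = cis (- (pi * t)) * (u + v * cis (2 * pi * t))" .
    have "(\<Sum>i\<le>Suc K. b' i * cis (2 * pi * real i * t))
        = (\<Sum>i\<le>Suc K. (if i \<le> K then u * b i else 0) * cis (2 * pi * real i * t))
        + (\<Sum>i\<le>Suc K. (if i = 0 then 0 else v * b (i - 1)) * cis (2 * pi * real i * t))"
      by (simp only: b'_def distrib_right sum.distrib)
    also have "(\<Sum>i\<le>Suc K. (if i \<le> K then u * b i else 0) * cis (2 * pi * real i * t)) = u * p"
      by (simp add: p_def sum_distrib_left mult.assoc)
    also have "(\<Sum>i\<le>Suc K. (if i = 0 then 0 else v * b (i - 1)) * cis (2 * pi * real i * t))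
        = v * cis (2 * pi * t) * p"
      by (subst sum.atMost_Suc_shift)
         (simp add: p_def sum_distrib_left cis_mult[symmetric] algebra_simps)
    finally have q: "(\<Sum>i\<le>Suc K. b' i * cis (2 * pi * real i * t)) = (u + v * cis (2 * pi * t)) * p"
      by (simp add: algebra_simps)
    have "cis (- (pi * real (Suc K) * t)) = cis (- (pi * real K * t)) * cis (- (pi * t))"
      by (simp add: cis_mult algebra_simps)
    then show "complex_of_real (\<Prod>j=1..Suc K. sin (pi * (x j - t)))
      = cis (- (pi * real (Suc K) * t)) * (\<Sum>i\<le>Suc K. b' i * cis (2 * pi * real i * t))"
      using b[of t] unfolding q by (simp add: s p_def mult_ac)
  qed
qed

text \<open>Multiplication by \<open>sin (\<pi>nt)\<close> shifts the frequencies \<open>-K/2, \<dots>, K/2\<close> of the product by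
  \<open>\<plusminus>n/2 = \<plusminus>(N + K/2)\<close>, onto the two blocks of integers.\<close>

lemma extremal_in_trig_span:
  fixes N K :: nat
  assumes "1 \<le> N"
  shows "extremal (2 * real N + real K) K
    \<in> trig_span ({- int N - int K .. - int N} \<union> {int N .. int N + int K})"
proof -
  define n where "n = 2 * real N + real K"
  obtain b where b: "\<And>t. complex_of_real (\<Prod>j=1..K. sin (pi * (real j / n - t)))
      = cis (- (pi * real K * t)) * (\<Sum>i\<le>K. b i * cis (2 * pi * real i * t))"
    using sine_product_expansion[of "\<lambda>j. real j / n" K] by blast
  define c where "c k = (if k < 0 then - b (nat (k + int N + int K)) else b (nat (k - int N))) / (2 * \<i>)" for k
  show ?thesis
    unfolding n_def[symmetric]
  proof (rule trig_spanI[where c = c])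
    fix t
    have "(\<Sum>k\<in>{- int N - int K .. - int N} \<union> {int N .. int N + int K}. c k * cis (2 * pi * of_int k * t))
        = (\<Sum>k=- int N - int K .. - int N. c k * cis (2 * pi * of_int k * t))
        + (\<Sum>k=int N .. int N + int K. c k * cis (2 * pi * of_int k * t))"
      using assms by (intro sum.union_disjoint) auto
    also have "(\<Sum>k=int N .. int N + int K. c k * cis (2 * pi * of_int k * t))
        = (\<Sum>i\<le>K. b i / (2 * \<i>) * cis (2 * pi * real (i + N) * t))"
      by (rule sum.reindex_bij_witness[of _ "\<lambda>i. int i + int N" "\<lambda>k. nat (k - int N)"])
         (auto simp: c_def)
    also have "(\<Sum>k=- int N - int K .. - int N. c k * cis (2 * pi * of_int k * t))
        = (\<Sum>i\<le>K. - b i / (2 * \<i>) * cis (2 * pi * (real i - real N - real K) * t))"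
      using assms
      by (intro sum.reindex_bij_witness[of _ "\<lambda>i. int i - int N - int K" "\<lambda>k. nat (k + int N + int K)"])
         (auto simp: c_def)
    also have "\<dots> + (\<Sum>i\<le>K. b i / (2 * \<i>) * cis (2 * pi * real (i + N) * t))
        = (cis (pi * n * t) - cis (- (pi * n * t))) / (2 * \<i>) *
          (cis (- (pi * real K * t)) * (\<Sum>i\<le>K. b i * cis (2 * pi * real i * t)))"
      unfolding sum_distrib_left sum.distrib[symmetric]
    proof (rule sum.cong[OF refl])
      fix i
      have "cis (2 * pi * real (i + N) * t) = cis (pi * n * t) * cis (- (pi * real K * t)) * cis (2 * pi * real i * t)"
        "cis (2 * pi * (real i - real N - real K) * t) = cis (- (pi * n * t)) * cis (- (pi * real K * t)) * cis (2 * pi * real i * t)"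
        by (simp_all add: cis_mult n_def algebra_simps)
      then show "- b i / (2 * \<i>) * cis (2 * pi * (real i - real N - real K) * t)
          + b i / (2 * \<i>) * cis (2 * pi * real (i + N) * t)
        = (cis (pi * n * t) - cis (- (pi * n * t))) / (2 * \<i>) *
          (cis (- (pi * real K * t)) * (b i * cis (2 * pi * real i * t)))"
        by (simp add: divide_simps) (simp add: algebra_simps)
    qed
    also have "\<dots> = complex_of_real (extremal n K t)"
      unfolding extremal_def of_real_mult b two_i_sin[symmetric] by simp
    finally show "complex_of_real (extremal n K t) =
      (\<Sum>k\<in>{- int N - int K .. - int N} \<union> {int N .. int N + int K}. c k * cis (2 * pi * of_int k * t))" ..
  qed
qed

lemma extremal_sign:
  fixes K :: nat and n :: real
  assumes n: "real K + 1 \<le> n" and t: "0 < t" "n * t < real K + 1"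
  shows "0 \<le> extremal n K t" and "n * t \<notin> \<int> \<Longrightarrow> 0 < extremal n K t"
proof -
  have npos: "0 < n" using n by linarith
  define p where "p = nat \<lfloor>n * t\<rfloor>"
  have nt: "0 < n * t" using npos t by simp
  then have p: "real p \<le> n * t" "n * t < real p + 1"
    unfolding p_def by (simp_all add: of_nat_nat)
  have pK: "p \<le> K" using p t by linarith
  have t1: "t < 1" using t(2) n npos by (smt (verit) mult_less_cancel_left2)
  \<comment> \<open>Between \<open>p/n\<close> and \<open>(p + 1)/n\<close> the factors with \<open>j \<le> p\<close> are reflected. The sign \<open>(-1)\<^sup>p\<close>
    this produces cancels the one of \<open>sin (\<pi>nt)\<close>.\<close>
  define A where "A = (\<Prod>j=1..p. sin (pi * (t - real j / n)))"
  define B where "B = (\<Prod>j=p+1..K. sin (pi * (real j / n - t)))"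
  have "sin (pi * n * t) = (-1) ^ p * sin (pi * (n * t - real p))"
    by (simp add: sin_diff algebra_simps flip: power_mult_distrib)
  moreover have "(\<Prod>j=1..K. sin (pi * (real j / n - t))) = (-1) ^ p * A * B"
  proof -
    have "{1..K} = {1..p} \<union> {p+1..K}" using pK by auto
    then have "(\<Prod>j=1..K. sin (pi * (real j / n - t)))
        = (\<Prod>j=1..p. sin (pi * (real j / n - t))) * B"
      unfolding B_def by (simp add: prod.union_disjoint)
    also have "(\<Prod>j=1..p. sin (pi * (real j / n - t))) = (\<Prod>j=1..p. - 1 * sin (pi * (t - real j / n)))"
    proof (rule prod.cong[OF refl])
      fix j
      show "sin (pi * (real j / n - t)) = - 1 * sin (pi * (t - real j / n))"
        using sin_minus[of "pi * (t - real j / n)"] by (simp add: algebra_simps)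
    qed
    also have "\<dots> = (-1) ^ p * A" unfolding prod.distrib A_def by simp
    finally show ?thesis .
  qed
  ultimately have E: "extremal n K t = sin (pi * (n * t - real p)) * A * B"
    by (simp add: extremal_def flip: power_mult_distrib)
  have B: "0 < B" unfolding B_def
  proof (intro prod_pos sin_gt_zero)
    fix j assume j: "j \<in> {p+1..K}"
    then have "real p + 1 \<le> real j" "real j \<le> real K" by auto
    then have "n * t < real j" "real j / n \<le> 1" using p n npos by (auto simp: field_simps)
    moreover from this have "t < real j / n" using npos by (simp add: field_simps)
    ultimately have "0 < real j / n - t" "real j / n - t < 1" using t(1) by linarith+
    then show "0 < pi * (real j / n - t)" "pi * (real j / n - t) < pi" by auto
  qed
  have Afac: "0 \<le> t - real j / n" "t - real j / n < 1" if "j \<in> {1..p}" for j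
  proof -
    have "real j \<le> n * t" using that p by auto
    then show "0 \<le> t - real j / n" using npos by (simp add: field_simps)
    have "0 \<le> real j / n" using npos by simp
    then show "t - real j / n < 1" using t1 by linarith
  qed
  have "0 \<le> A" unfolding A_def using Afac
    by (intro prod_nonneg sin_ge_zero) (auto simp: less_imp_le)
  moreover have "0 \<le> sin (pi * (n * t - real p))" using p by (intro sin_ge_zero) auto
  ultimately show "0 \<le> extremal n K t" unfolding E using B by simp
  assume nonint: "n * t \<notin> \<int>"
  then have "n * t \<noteq> real p" by auto
  then have lt: "real p < n * t" using p by simp
  have "0 < A" unfolding A_def
  proof (intro prod_pos sin_gt_zero)
    fix j assume j: "j \<in> {1..p}"
    then have "real j < n * t" using lt by auto
    then have "0 < t - real j / n" using npos by (simp add: field_simps)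
    then show "0 < pi * (t - real j / n)" "pi * (t - real j / n) < pi" using Afac(2)[OF j] by auto
  qed
  moreover have "0 < sin (pi * (n * t - real p))" using lt p by (intro sin_gt_zero) auto
  ultimately show "0 < extremal n K t" unfolding E using B by simp
qed

text \<open>The double zeros at \<open>j/n\<close> are removed by adding a translate: \<open>nt\<close> and \<open>n(t - s)\<close> are not
  both integers when \<open>0 < ns < 1\<close>.\<close>

lemma extremal_add_translate_pos:
  fixes K :: nat and n s t :: real
  assumes n: "real K + 1 \<le> n" and s: "0 < s" "n * s < 1" and t: "s < t" "n * t < real K + 1"
  shows "0 < extremal n K t + extremal n K (t - s)"
proof -
  have npos: "0 < n" using n by linarith
  have ts: "0 < t - s" "n * (t - s) < real K + 1" "0 < t"
    using s t mult_pos_pos[OF npos s(1)] by (simp_all add: right_diff_distrib)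
  show ?thesis
  proof (cases "n * t \<in> \<int>")
    case False
    then have "0 < extremal n K t" using extremal_sign(2)[OF n ts(3) t(2)] by blast
    with extremal_sign(1)[OF n ts(1,2)] show ?thesis by simp
  next
    case True
    have "n * (t - s) \<notin> \<int>"
    proof
      assume "n * (t - s) \<in> \<int>"
      with True have "n * t - n * (t - s) \<in> \<int>" by (rule Ints_diff)
      then obtain i where i: "n * s = of_int i" by (auto simp: algebra_simps elim: Ints_cases)
      have "0 < n * s" using npos s by simp
      with i s show False by simp
    qed
    then have "0 < extremal n K (t - s)" using extremal_sign(2)[OF n ts(1,2)] by blast
    with extremal_sign(1)[OF n ts(3) t(2)] show ?thesis by simp
  qed
qed

section \<open>The value of the supremum\<close>

theorem theorem2:
  fixes N K :: nat and S :: "int set"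
  assumes "N \<ge> 1" and "K \<ge> 1"
    and "S = {- int N - int K .. - int N} \<union> {int N .. int N + int K}"
  shows "M S = (real K + 1) / (2 * real N + real K)"
proof -
  define n where "n = 2 * real N + real K"
  define d where "d = (real K + 1) / n"
  have n: "0 < n" "real K + 1 \<le> n" using assms(1) by (auto simp: n_def)
  have d: "0 \<le> d" "d \<le> 1" "n * d = real K + 1" using n by (auto simp: d_def)
  define \<mu> where "\<mu> f = (SUP I\<in>zero_free_intervals f. measure lborel I)" for f
  have "{f. trig_polynomial f \<and> spec f \<subseteq> S} = trig_span S"
    using trig_polynomial_iff_trig_span[of S] assms(3) by auto
  then have M: "M S = (SUP f\<in>trig_span S. \<mu> f)"
    by (simp add: M_def \<mu>_def)
  have I_le: "measure lborel I \<le> d" if "f \<in> trig_span S" "I \<in> zero_free_intervals f" for f I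
    using that zero_free_distance[OF assms(1), of f K I] d(1) unfolding assms(3) d_def n_def
    by (intro measure_interval_le[of I 0 1]) (auto simp: zero_free_intervals_def)
  have ne: "zero_free_intervals f \<noteq> {}" for f
    by (auto simp: zero_free_intervals_def intro!: exI[of _ "{}"])
  have \<mu>_le: "\<mu> f \<le> d" if "f \<in> trig_span S" for f
    unfolding \<mu>_def using that by (intro cSUP_least ne I_le)
  have ex: "extremal n K \<in> trig_span S"
    using extremal_in_trig_span[OF assms(1)] unfolding n_def assms(3) .
  have "M S \<le> d"
    unfolding M using ex \<mu>_le by (intro cSUP_least) auto
  moreover have "d \<le> M S"
  proof (rule field_le_epsilon)
    fix e :: real assume e: "0 < e"
    define s where "s = min e (1 / (2 * n))"
    have s: "0 < s" "s \<le> e" "n * s < 1" using e n by (auto simp: s_def min_def field_simps)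
    have "n * s \<le> n * d" using s d by simp
    then have sd: "s \<le> d" using n by simp
    define g where "g t = extremal n K t + extremal n K (t - s)" for t
    have g: "g \<in> trig_span S"
      unfolding g_def using ex by (intro trig_span_add trig_span_translate)
    have "0 < g t" if "s < t" "t < d" for t
      unfolding g_def using that s d n mult_strict_left_mono[of t d n]
      by (intro extremal_add_translate_pos) auto
    then have I: "{s<..<d} \<in> zero_free_intervals g"
      using s d by (force simp: zero_free_intervals_def is_interval_oo)
    have "d - s = measure lborel {s<..<d}" using sd by simp
    also have "\<dots> \<le> \<mu> g"
      unfolding \<mu>_def using I_le[OF g] by (intro cSUP_upper I bdd_aboveI2)
    also have "\<dots> \<le> M S"
      unfolding M using \<mu>_le by (intro cSUP_upper g bdd_aboveI2)
    finally show "d \<le> M S + e" using s by simp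
  qed
  ultimately show ?thesis by (simp add: d_def n_def)
qed

end
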